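(* For all integers $g\ge 2$ one has $$\mu_g \ \le \ \frac{\sqrt{4g-2}}{2g}+\frac{1}{4g}.$$ In particular $\mu_2\le \frac{\sqrt 6}{4}+\frac18\approx 0.7373$.
   Context: For $g\ge 2$ let $\Gamma_g$ be the fundamental group of the closed orientable surface of genus $g$, given by the presentation $\Gamma_g=\langle a_1,b_1,\dots,a_g,b_g \mid \prod_{j=1}^g a_jb_ja_j^{-1}b_j^{-1}=1\rangle$, and let $S_g=\{a_1,a_1^{-1},b_1,b_1^{-1},\dots,a_g,a_g^{-1},b_g,b_g^{-1}\}$, a symmetric generating set with $4g$ elements. The Cayley graph $X_g=\mathrm{Cay}(\Gamma_g,S_g)$ has vertex set $\Gamma_g$, with $\{x,y\}$ an edge if and only if $x^{-1}y\in S_g$; it is $4g$-regular. The Markov operator $M$ of a connected $k$-regular graph with vertex set $X^0$ is $(Mf)(x)=\frac1k\sum_{y\sim x}f(y)$ (sum over neighbours $y$ of $x$), a bounded self-adjoint operator on $\ell^2(X^0)$; the spectral radius of the graph is the operator norm of $M$ on $\ell^2(X^0)$. The number $\mu_g$ is the spectral radius of $X_g$. *)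

theory Defs
  imports "HOL-Analysis.Analysis" "HOL-Algebra.Group"
begin

section \<open>Groups given by generators and relators\<close>

text \<open>The letter \<open>(x, True)\<close> stands for the generator \<open>x\<close> and \<open>(x, False)\<close> for its formal inverse.\<close>

type_synonym 'a word = "('a \<times> bool) list"

definition words :: "'a set \<Rightarrow> 'a word set" where
  "words X = lists (X \<times> UNIV)"

text \<open>Two words are equal in the group with generators \<open>X\<close> and relators \<open>R\<close> iff one can be turned
  into the other by finitely many insertions and deletions of subwords that are relators or of
  the form $x x^{-1}$ or $x^{-1} x$.\<close>

inductive word_eq :: "'a set \<Rightarrow> 'a word set \<Rightarrow> 'a word \<Rightarrow> 'a word \<Rightarrow> bool" for X R where
  cancel: "u \<in> words X \<Longrightarrow> v \<in> words X \<Longrightarrow> x \<in> X \<Longrightarrow>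
             word_eq X R (u @ [(x, e), (x, \<not> e)] @ v) (u @ v)"
| relator: "u \<in> words X \<Longrightarrow> v \<in> words X \<Longrightarrow> r \<in> R \<Longrightarrow> r \<in> words X \<Longrightarrow>
             word_eq X R (u @ r @ v) (u @ v)"
| refl: "u \<in> words X \<Longrightarrow> word_eq X R u u"
| sym: "word_eq X R u v \<Longrightarrow> word_eq X R v u"
| trans: "word_eq X R u v \<Longrightarrow> word_eq X R v w \<Longrightarrow> word_eq X R u w"

definition word_rel :: "'a set \<Rightarrow> 'a word set \<Rightarrow> ('a word \<times> 'a word) set" where
  "word_rel X R = {(u, v). word_eq X R u v}"

definition word_class :: "'a set \<Rightarrow> 'a word set \<Rightarrow> 'a word \<Rightarrow> 'a word set" where
  "word_class X R u = word_rel X R `` {u}"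

definition presented_group :: "'a set \<Rightarrow> 'a word set \<Rightarrow> 'a word set monoid" where
  "presented_group X R =
     \<lparr>carrier = words X // word_rel X R,
      mult = (\<lambda>P Q. word_rel X R `` {u @ v |u v. u \<in> P \<and> v \<in> Q}),
      one = word_class X R []\<rparr>"

lemma words_append [simp]: "u @ v \<in> words X \<longleftrightarrow> u \<in> words X \<and> v \<in> words X"
  by (auto simp: words_def)

lemma words_Nil [simp]: "[] \<in> words X"
  by (simp add: words_def)

lemma words_Cons [simp]: "(x, e) # v \<in> words X \<longleftrightarrow> x \<in> X \<and> v \<in> words X"
  by (auto simp: words_def)

lemma word_eq_words: "word_eq X R u v \<Longrightarrow> u \<in> words X \<and> v \<in> words X"
  by (induction rule: word_eq.induct) auto

lemma equiv_word_rel: "equiv (words X) (word_rel X R)"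
  unfolding equiv_def refl_on_def sym_def trans_def word_rel_def
  by (auto intro: word_eq.intros dest: word_eq_words)

lemma word_eq_context:
  assumes "word_eq X R u v" "p \<in> words X" "q \<in> words X"
  shows "word_eq X R (p @ u @ q) (p @ v @ q)"
  using assms
proof (induction rule: word_eq.induct)
  case (cancel u v x e)
  then show ?case using word_eq.cancel[of "p @ u" X "v @ q" x R e] by simp
next
  case (relator u v r)
  then show ?case using word_eq.relator[of "p @ u" X "v @ q" r R] by simp
qed (auto intro: word_eq.intros)

lemma word_eq_append:
  assumes "word_eq X R u u'" "word_eq X R v v'"
  shows "word_eq X R (u @ v) (u' @ v')"
proof -
  note w = word_eq_words[OF assms(1)] word_eq_words[OF assms(2)]
  have "word_eq X R (u @ v) (u' @ v)"
    using word_eq_context[OF assms(1), of "[]" v] w by simp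
  moreover have "word_eq X R (u' @ v) (u' @ v')"
    using word_eq_context[OF assms(2), of u' "[]"] w by simp
  ultimately show ?thesis by (rule word_eq.trans)
qed

lemma word_class_eq_iff:
  assumes "u \<in> words X" "v \<in> words X"
  shows "word_class X R u = word_class X R v \<longleftrightarrow> word_eq X R u v"
  using eq_equiv_class_iff[OF equiv_word_rel assms, of R]
  by (simp add: word_class_def word_rel_def)

lemma carrier_presented_group: "carrier (presented_group X R) = word_class X R ` words X"
  by (auto simp: presented_group_def quotient_def word_class_def)

lemma one_presented_group: "\<one>\<^bsub>presented_group X R\<^esub> = word_class X R []"
  by (simp add: presented_group_def)

lemma mult_presented_group:
  assumes "u \<in> words X" "v \<in> words X"
  shows "word_class X R u \<otimes>\<^bsub>presented_group X R\<^esub> word_class X R v = word_class X R (u @ v)"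
proof -
  have "word_eq X R (u @ v) w" if "word_eq X R u u'" "word_eq X R v v'" "word_eq X R (u' @ v') w"
    for u' v' w
    using that word_eq_append word_eq.trans by metis
  then show ?thesis
    using assms by (fastforce simp: presented_group_def word_class_def word_rel_def
        intro: word_eq.refl)
qed

definition word_inv :: "'a word \<Rightarrow> 'a word" where
  "word_inv u = rev (map (\<lambda>(x, e). (x, \<not> e)) u)"

lemma word_inv_words: "u \<in> words X \<Longrightarrow> word_inv u \<in> words X"
  by (auto simp: word_inv_def words_def)

lemma word_inv_left: "u \<in> words X \<Longrightarrow> word_eq X R (word_inv u @ u) []"
proof (induction u)
  case (Cons a u)
  obtain x e where a: "a = (x, e)" by (cases a)
  have u: "x \<in> X" "u \<in> words X" using Cons.prems a by auto
  have "word_eq X R (word_inv u @ [(x, \<not> e), (x, \<not> \<not> e)] @ u) (word_inv u @ u)"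
    using u word_inv_words by (intro word_eq.cancel) auto
  with Cons.IH[OF u(2)] show ?case
    by (auto simp: a word_inv_def intro: word_eq.trans)
qed (auto simp: word_inv_def intro: word_eq.refl)

lemma group_presented_group: "group (presented_group X R)"
proof (rule groupI)
  fix P assume "P \<in> carrier (presented_group X R)"
  then obtain u where u: "u \<in> words X" "P = word_class X R u"
    by (auto simp: carrier_presented_group)
  show "\<one>\<^bsub>presented_group X R\<^esub> \<otimes>\<^bsub>presented_group X R\<^esub> P = P"
    using u by (simp add: one_presented_group mult_presented_group)
  have "word_class X R (word_inv u) \<otimes>\<^bsub>presented_group X R\<^esub> P = \<one>\<^bsub>presented_group X R\<^esub>"
    using u word_inv_words[OF u(1)] word_inv_left[OF u(1)]
    by (simp add: one_presented_group mult_presented_group word_class_eq_iff)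
  then show "\<exists>Q\<in>carrier (presented_group X R).
      Q \<otimes>\<^bsub>presented_group X R\<^esub> P = \<one>\<^bsub>presented_group X R\<^esub>"
    using word_inv_words[OF u(1)] by (auto simp: carrier_presented_group)
qed (auto simp: carrier_presented_group one_presented_group mult_presented_group)

section \<open>Simple graphs, Cayley graphs and the Markov operator\<close>

definition neighbours :: "'v set set \<Rightarrow> 'v \<Rightarrow> 'v set" where
  "neighbours E x = {y. {x, y} \<in> E}"

definition cayley_edges :: "('a, 'b) monoid_scheme \<Rightarrow> 'a set \<Rightarrow> 'a set set" where
  "cayley_edges G S =
     {{x, y} |x y. x \<in> carrier G \<and> y \<in> carrier G \<and> inv\<^bsub>G\<^esub> x \<otimes>\<^bsub>G\<^esub> y \<in> S}"

text \<open>In a $k$-regular graph the cardinality below is $k$ at every vertex.\<close>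

definition markov :: "'v set set \<Rightarrow> ('v \<Rightarrow> complex) \<Rightarrow> 'v \<Rightarrow> complex" where
  "markov E f x = 1 / of_nat (card (neighbours E x)) * (\<Sum>y\<in>neighbours E x. f y)"

text \<open>Elements of $\ell^2(V)$ are represented by total functions; only their values on \<open>V\<close> matter.\<close>

definition ell2 :: "'v set \<Rightarrow> ('v \<Rightarrow> complex) set" where
  "ell2 V = {f. (\<lambda>x. (cmod (f x))\<^sup>2) summable_on V}"

definition ell2_norm :: "'v set \<Rightarrow> ('v \<Rightarrow> complex) \<Rightarrow> real" where
  "ell2_norm V f = sqrt (\<Sum>\<^sub>\<infinity>x\<in>V. (cmod (f x))\<^sup>2)"

text \<open>Meaningful for bounded operators; for others the set of bounds is empty and the value
  is unspecified.\<close>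

definition ell2_opnorm :: "'v set \<Rightarrow> (('v \<Rightarrow> complex) \<Rightarrow> ('v \<Rightarrow> complex)) \<Rightarrow> real" where
  "ell2_opnorm V T =
     Inf {c. 0 \<le> c \<and> (\<forall>f\<in>ell2 V. T f \<in> ell2 V \<and> ell2_norm V (T f) \<le> c * ell2_norm V f)}"

definition graph_spectral_radius :: "'v set \<Rightarrow> 'v set set \<Rightarrow> real" where
  "graph_spectral_radius V E = ell2_opnorm V (markov E)"

section \<open>Surface groups\<close>

datatype surface_gen = Gen_a nat | Gen_b nat

definition surface_gens :: "nat \<Rightarrow> surface_gen set" where
  "surface_gens g = Gen_a ` {1..g} \<union> Gen_b ` {1..g}"

definition surface_relator :: "nat \<Rightarrow> surface_gen word" where
  "surface_relator g =
     concat (map (\<lambda>j. [(Gen_a j, True), (Gen_b j, True), (Gen_a j, False), (Gen_b j, False)]) [1..<g + 1])"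

definition surface_group :: "nat \<Rightarrow> surface_gen word set monoid" where
  "surface_group g = presented_group (surface_gens g) {surface_relator g}"

definition surface_elem :: "nat \<Rightarrow> surface_gen \<Rightarrow> surface_gen word set" where
  "surface_elem g x = word_class (surface_gens g) {surface_relator g} [(x, True)]"

definition surface_gen_set :: "nat \<Rightarrow> surface_gen word set set" where
  "surface_gen_set g =
     (\<Union>j\<in>{1..g}. {surface_elem g (Gen_a j), inv\<^bsub>surface_group g\<^esub> (surface_elem g (Gen_a j)),
                  surface_elem g (Gen_b j), inv\<^bsub>surface_group g\<^esub> (surface_elem g (Gen_b j))})"

definition surface_mu :: "nat \<Rightarrow> real" where
  "surface_mu g =
     graph_spectral_radius (carrier (surface_group g))
       (cayley_edges (surface_group g) (surface_gen_set g))"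

lemma surface_relator_words: "surface_relator g \<in> words (surface_gens g)"
  by (auto simp: surface_relator_def words_def surface_gens_def)

lemma group_surface_group: "group (surface_group g)"
  by (simp add: surface_group_def group_presented_group)

subsection \<open>The Cayley graph is $4g$-regular\<close>

definition exponent_sum :: "'a \<Rightarrow> 'a word \<Rightarrow> int" where
  "exponent_sum c u = (\<Sum>(x, e)\<leftarrow>u. if x = c then (if e then 1 else - 1) else 0)"

lemma exponent_sum_word_eq:
  assumes "word_eq X R u v" "\<And>r. r \<in> R \<Longrightarrow> exponent_sum c r = 0"
  shows "exponent_sum c u = exponent_sum c v"
  using assms by (induction rule: word_eq.induct) (auto simp: exponent_sum_def)

lemma exponent_sum_surface_relator: "exponent_sum c (surface_relator g) = 0"
proof -
  have "exponent_sum c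
      (concat (map (\<lambda>j. [(Gen_a j, True), (Gen_b j, True), (Gen_a j, False), (Gen_b j, False)]) js)) = 0" for js
    by (induction js) (auto simp: exponent_sum_def)
  then show ?thesis by (simp add: surface_relator_def)
qed

lemma inj_surface_letters:
  "inj_on (\<lambda>l. word_class (surface_gens g) {surface_relator g} [l]) (surface_gens g \<times> UNIV)"
proof (rule inj_onI; clarify)
  fix x e y d
  assume xy: "x \<in> surface_gens g" "y \<in> surface_gens g"
    and "word_class (surface_gens g) {surface_relator g} [(x, e)] =
         word_class (surface_gens g) {surface_relator g} [(y, d)]"
  then have "word_eq (surface_gens g) {surface_relator g} [(x, e)] [(y, d)]"
    using word_class_eq_iff[of "[(x, e)]" "surface_gens g" "[(y, d)]"] by simp
  then have "exponent_sum x [(x, e)] = exponent_sum x [(y, d)]"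
    by (rule exponent_sum_word_eq) (auto simp: exponent_sum_surface_relator)
  then show "x = y \<and> e = d"
    by (auto simp: exponent_sum_def split: if_splits)
qed

lemma surface_elem_carrier:
  "x \<in> surface_gens g \<Longrightarrow> surface_elem g x \<in> carrier (surface_group g)"
  by (auto simp: surface_elem_def surface_group_def carrier_presented_group)

lemma inv_surface_elem:
  assumes "x \<in> surface_gens g"
  shows "inv\<^bsub>surface_group g\<^esub> (surface_elem g x) =
         word_class (surface_gens g) {surface_relator g} [(x, False)]"
proof (rule group.inv_equality[OF group_surface_group _ surface_elem_carrier[OF assms]])
  have "word_eq (surface_gens g) {surface_relator g} [(x, False), (x, True)] []"
    using word_eq.cancel[of "[]" _ "[]" x _ False] assms by simp
  then show "word_class (surface_gens g) {surface_relator g} [(x, False)]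
      \<otimes>\<^bsub>surface_group g\<^esub> surface_elem g x = \<one>\<^bsub>surface_group g\<^esub>"
    using assms by (simp add: surface_group_def surface_elem_def mult_presented_group
        one_presented_group word_class_eq_iff)
  show "word_class (surface_gens g) {surface_relator g} [(x, False)] \<in> carrier (surface_group g)"
    using assms by (auto simp: surface_group_def carrier_presented_group)
qed

lemma surface_gen_set_eq:
  "surface_gen_set g =
   (\<lambda>l. word_class (surface_gens g) {surface_relator g} [l]) ` (surface_gens g \<times> UNIV)"
  (is "?S = ?f ` _")
proof -
  have "?S = (\<Union>x\<in>surface_gens g. {surface_elem g x, inv\<^bsub>surface_group g\<^esub> (surface_elem g x)})"
    by (auto simp: surface_gen_set_def surface_gens_def)
  also have "\<dots> = (\<Union>x\<in>surface_gens g. {?f (x, True), ?f (x, False)})"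
    by (intro SUP_cong refl arg_cong2[of _ _ _ _ insert])
      (simp_all add: inv_surface_elem, simp_all add: surface_elem_def)
  also have "\<dots> = ?f ` (surface_gens g \<times> UNIV)"
    by (auto simp: UNIV_bool)
  finally show ?thesis .
qed

lemma card_surface_gen_set: "card (surface_gen_set g) = 4 * g"
proof -
  have "card (surface_gens g) = 2 * g"
    unfolding surface_gens_def by (subst card_Un_disjoint) (auto simp: card_image inj_on_def)
  then show ?thesis
    by (simp add: surface_gen_set_eq card_image[OF inj_surface_letters] card_cartesian_product)
qed

lemma surface_gen_set_carrier: "surface_gen_set g \<subseteq> carrier (surface_group g)"
  by (auto simp: surface_gen_set_eq surface_group_def carrier_presented_group)

lemma surface_gen_set_inv:
  "s \<in> surface_gen_set g \<Longrightarrow> inv\<^bsub>surface_group g\<^esub> s \<in> surface_gen_set g"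
  using group.inv_inv[OF group_surface_group] surface_elem_carrier
  by (fastforce simp: surface_gen_set_def surface_gens_def)

lemma neighbours_cayley_edges:
  assumes "group G" "S \<subseteq> carrier G" "\<And>s. s \<in> S \<Longrightarrow> inv\<^bsub>G\<^esub> s \<in> S" "x \<in> carrier G"
  shows "neighbours (cayley_edges G S) x = (\<lambda>s. x \<otimes>\<^bsub>G\<^esub> s) ` S"
proof -
  interpret group G by fact
  have "y \<in> neighbours (cayley_edges G S) x \<longleftrightarrow> y \<in> carrier G \<and> inv\<^bsub>G\<^esub> x \<otimes>\<^bsub>G\<^esub> y \<in> S" for y
  proof -
    have "inv\<^bsub>G\<^esub> x \<otimes>\<^bsub>G\<^esub> y \<in> S" if "inv\<^bsub>G\<^esub> y \<otimes>\<^bsub>G\<^esub> x \<in> S" "y \<in> carrier G"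
      using assms(3)[OF that(1)] that assms(4) by (simp add: inv_mult_group)
    then show ?thesis
      using assms(4) by (auto simp: neighbours_def cayley_edges_def doubleton_eq_iff)
  qed
  moreover have "y \<in> (\<lambda>s. x \<otimes>\<^bsub>G\<^esub> s) ` S \<longleftrightarrow> y \<in> carrier G \<and> inv\<^bsub>G\<^esub> x \<otimes>\<^bsub>G\<^esub> y \<in> S" for y
  proof
    assume "y \<in> carrier G \<and> inv\<^bsub>G\<^esub> x \<otimes>\<^bsub>G\<^esub> y \<in> S"
    then show "y \<in> (\<lambda>s. x \<otimes>\<^bsub>G\<^esub> s) ` S"
      using assms(4) by (intro image_eqI[of _ _ "inv\<^bsub>G\<^esub> x \<otimes>\<^bsub>G\<^esub> y"]) (auto simp: m_assoc[symmetric])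
  qed (use assms(2,4) in \<open>auto simp: m_assoc[symmetric]\<close>)
  ultimately show ?thesis by blast
qed

lemma surface_cayley_regular:
  assumes "x \<in> carrier (surface_group g)"
  shows "card (neighbours (cayley_edges (surface_group g) (surface_gen_set g)) x) = 4 * g"
proof -
  have "inj_on (\<lambda>s. x \<otimes>\<^bsub>surface_group g\<^esub> s) (surface_gen_set g)"
    by (meson assms group.inj_on_cmult group_surface_group inj_on_subset surface_gen_set_carrier)
  then show ?thesis
    using neighbours_cayley_edges[OF group_surface_group surface_gen_set_carrier
        surface_gen_set_inv assms]
    by (simp add: card_image card_surface_gen_set)
qed

end

(* If every oriented edge e of a d-regular graph carries a weight w(e) > 0 with w(e) w(e^-1) = 1 and
   the weights of the edges leaving any vertex add up to at most C, then the spectral radius is at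
   most C / d.  Such weights can be pulled back from any set on which the group acts by
   permutations, so no solution of the word problem in the surface group is needed.

   Write s = a_1, b = b_1, W = [a_2,b_2]...[a_g,b_g] and u = W^-1 b, so that the relation is
   s b s^-1 = u.  On the set V of reduced words let the generators other than s act by right
   multiplication (the resulting graph is a forest), and let s be any permutation that carries the
   orbits of u to those of b equivariantly.  Base points of these orbits can be chosen such that
   every word is the base point of its u-orbit or of its b-orbit, and the bijection between the two
   sets of base points can be chosen such that each pair contains a root of one of infinitely many
   trees.  Orienting these s-edges away from the roots, every vertex has at most one parent and at
   most one unoriented edge.  With weight k = sqrt (4g - 2) towards the parent, 1/k towards a child
   and 1 on unoriented edges, the sum at a vertex is at most k + 1 + (4g - 2) / k = 2k + 1. *)
theory Submission
  imports Defs "HOL-Library.Sublist"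
begin

section \<open>Permutations with infinite orbits\<close>

text \<open>\<open>A\<close> and \<open>B\<close> are the points lying on the positive and on the negative side of the base point
  of their orbit.\<close>

locale line_perm =
  fixes V :: "'v set" and p p' :: "'v \<Rightarrow> 'v" and A B :: "'v set" and m :: "'v \<Rightarrow> nat"
  assumes p_in: "v \<in> V \<Longrightarrow> p v \<in> V" and p'_in: "v \<in> V \<Longrightarrow> p' v \<in> V"
    and p'_p: "v \<in> V \<Longrightarrow> p' (p v) = v" and p_p': "v \<in> V \<Longrightarrow> p (p' v) = v"
    and disj: "A \<inter> B = {}"
    and up: "v \<in> V \<Longrightarrow> v \<notin> B \<Longrightarrow> p v \<in> A"
    and down: "v \<in> V \<Longrightarrow> v \<notin> A \<Longrightarrow> p' v \<in> B"
    and descent_A: "v \<in> V \<Longrightarrow> v \<in> A \<Longrightarrow> p' v \<notin> A \<union> B \<or> m (p' v) < m v"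
    and descent_B: "v \<in> V \<Longrightarrow> v \<in> B \<Longrightarrow> p v \<notin> A \<union> B \<or> m (p v) < m v"
begin

definition base :: "'v set" where
  "base = V - (A \<union> B)"

definition zpow :: "int \<Rightarrow> 'v \<Rightarrow> 'v" where
  "zpow n v = (if 0 \<le> n then (p ^^ nat n) v else (p' ^^ nat (- n)) v)"

lemma base_subset: "base \<subseteq> V"
  by (auto simp: base_def)

lemma p_funpow_in: "v \<in> V \<Longrightarrow> (p ^^ n) v \<in> V"
  by (induction n) (auto intro: p_in)

lemma p'_funpow_in: "v \<in> V \<Longrightarrow> (p' ^^ n) v \<in> V"
  by (induction n) (auto intro: p'_in)

lemma zpow_in: "v \<in> V \<Longrightarrow> zpow n v \<in> V"
  by (simp add: zpow_def p_funpow_in p'_funpow_in)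

lemma zpow_0 [simp]: "zpow 0 v = v"
  by (simp add: zpow_def)

lemma zpow_succ:
  assumes "v \<in> V"
  shows "zpow (n + 1) v = p (zpow n v)"
proof (cases "0 \<le> n")
  case True
  then show ?thesis by (simp add: zpow_def nat_add_distrib)
next
  case False
  then have "nat (- n) = Suc (nat (- (n + 1)))" by simp
  then have "p (zpow n v) = p (p' ((p' ^^ nat (- (n + 1))) v))"
    using False by (simp add: zpow_def)
  also have "\<dots> = (p' ^^ nat (- (n + 1))) v"
    using assms by (simp add: p_p' p'_funpow_in)
  also have "\<dots> = zpow (n + 1) v"
    using False by (auto simp: zpow_def)
  finally show ?thesis by simp
qed

lemma zpow_pred:
  assumes "v \<in> V"
  shows "zpow (n - 1) v = p' (zpow n v)"
  using zpow_succ[OF assms, of "n - 1"] p'_p[OF zpow_in[OF assms, of "n - 1"]] by simp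

text \<open>An orbit that has entered \<open>A\<close> stays there: \<open>A\<close> is disjoint
  from \<open>B\<close>, so \<open>up\<close> applies again at each later point.\<close>

lemma zpow_pos:
  assumes "z \<in> base"
  shows "zpow (int n + 1) z \<in> A"
proof (induction n)
  case 0
  then show ?case using assms up[of z] zpow_succ[of z 0] by (simp add: base_def)
next
  case (Suc n)
  have "zpow (int n + 1) z \<in> V" using assms base_subset zpow_in by auto
  moreover have "zpow (int n + 1) z \<notin> B" using Suc disj by blast
  ultimately have "p (zpow (int n + 1) z) \<in> A" by (rule up)
  then show ?case using zpow_succ[of z "int n + 1"] assms base_subset by (auto simp: ac_simps)
qed

lemma zpow_neg:
  assumes "z \<in> base"
  shows "zpow (- int n - 1) z \<in> B"
proof (induction n)
  case 0
  then show ?case using assms down[of z] zpow_pred[of z 0] by (simp add: base_def)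
next
  case (Suc n)
  have "zpow (- int n - 1) z \<in> V" using assms base_subset zpow_in by auto
  moreover have "zpow (- int n - 1) z \<notin> A" using Suc disj by blast
  ultimately have "p' (zpow (- int n - 1) z) \<in> B" by (rule down)
  then show ?case using zpow_pred[of z "- int n - 1"] assms base_subset by (auto simp: algebra_simps)
qed

lemma zpow_base_iff:
  assumes "z \<in> base"
  shows "zpow n z \<in> base \<longleftrightarrow> n = 0"
proof -
  have "zpow n z \<notin> base" if "n > 0"
    using zpow_pos[OF assms, of "nat (n - 1)"] that by (simp add: base_def)
  moreover have "zpow n z \<notin> base" if "n < 0"
    using zpow_neg[OF assms, of "nat (- n - 1)"] that by (simp add: base_def)
  ultimately show ?thesis using assms by (metis linorder_neqE_linordered_idom zpow_0)
qed

lemma zpow_shift: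
  assumes "v \<in> V" "w \<in> V" "zpow i v = zpow j w"
  shows "zpow (i + int k) v = zpow (j + int k) w \<and> zpow (i - int k) v = zpow (j - int k) w"
proof (induction k)
  case (Suc k)
  have "i + int (Suc k) = (i + int k) + 1" "j + int (Suc k) = (j + int k) + 1"
    "i - int (Suc k) = (i - int k) - 1" "j - int (Suc k) = (j - int k) - 1" by auto
  then show ?case using Suc assms zpow_succ zpow_pred by metis
qed (use assms in auto)

text \<open>Every orbit is a copy of the integers with exactly one base point as origin. If two base
  points share an orbit, a shift of exponents makes one a power of the other, and neither side of an
  origin contains base points. Descent along \<open>m\<close> leads from any point back to an
  origin.\<close>

lemma bij_betw_zpow: "bij_betw (\<lambda>(z, n). zpow n z) (base \<times> UNIV) V"
  unfolding bij_betw_def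
proof (intro conjI)
  have eq: "z = w \<and> i = j" if zw: "z \<in> base" "w \<in> base" and e: "zpow i z = zpow j w" for z w i j
  proof -
    have V: "z \<in> V" "w \<in> V" using zw base_subset by auto
    \<comment> \<open>\<open>zpow_shift\<close> moves by natural numbers only, so the sign of
      \<open>j\<close> selects the half that cancels it.\<close>
    have "zpow (i - j) z = zpow (j - j) w"
      using zpow_shift[OF V e, of "nat j"] zpow_shift[OF V e, of "nat (- j)"]
      by (cases "0 \<le> j") auto
    then have "zpow (i - j) z = w" by simp
    then have "i - j = 0" using zpow_base_iff[OF zw(1)] zw(2) by metis
    with \<open>zpow (i - j) z = w\<close> show ?thesis by simp
  qed
  show "inj_on (\<lambda>(z, n). zpow n z) (base \<times> UNIV)"
    by (rule inj_onI) (auto dest: eq)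
  have "\<exists>z\<in>base. \<exists>n. v = zpow n z" if "v \<in> V" for v
    using that
  proof (induction "m v" arbitrary: v rule: less_induct)
    case less
    \<comment> \<open>The descent conditions allow \<open>m\<close> to grow when the step lands on a
      base point; the induction hypothesis covers the other case.\<close>
    have step: "\<exists>z\<in>base. \<exists>n. w = zpow n z" if "w \<in> V" "w \<notin> A \<union> B \<or> m w < m v" for w
      using that less.hyps[of w] by (metis DiffI base_def zpow_0)
    consider "v \<in> base" | "v \<in> A" | "v \<in> B" using less.prems by (auto simp: base_def)
    then show ?case
    proof cases
      case 1
      then show ?thesis by (metis zpow_0)
    next
      case 2
      then obtain z n where "z \<in> base" "p' v = zpow n z"
        using step[OF p'_in] descent_A less.prems by blast
      then have "v = zpow (n + 1) z" "z \<in> base"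
        using p_p'[OF less.prems] zpow_succ base_subset by auto
      then show ?thesis by blast
    next
      case 3
      then obtain z n where "z \<in> base" "p v = zpow n z"
        using step[OF p_in] descent_B less.prems by blast
      then have "v = zpow (n - 1) z" "z \<in> base"
        using p'_p[OF less.prems] zpow_pred base_subset by auto
      then show ?thesis by blast
    qed
  qed
  then show "(\<lambda>(z, n). zpow n z) ` (base \<times> UNIV) = V"
    using base_subset zpow_in by (fastforce simp: image_iff)
qed

end

text \<open>In the coordinates (origin, exponent) both permutations add 1 to the exponent, so a
  bijection of origins extends equivariantly by keeping the exponent.\<close>

lemma line_perm_conjugator:
  assumes "line_perm V p p' A B m" "line_perm V q q' C D k"
    and \<tau>: "bij_betw \<tau> (line_perm.base V A B) (line_perm.base V C D)"
  shows "\<exists>t. bij_betw t V V \<and> (\<forall>v\<in>V. t (p v) = q (t v)) \<and> (\<forall>z\<in>line_perm.base V A B. t z = \<tau> z)"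
proof -
  interpret P: line_perm V p p' A B m by fact
  interpret Q: line_perm V q q' C D k by fact
  define f where "f = (\<lambda>(z, n). P.zpow n z)"
  define h where "h = (\<lambda>(z, n). Q.zpow n z)"
  define t where "t = h \<circ> map_prod \<tau> id \<circ> the_inv_into (P.base \<times> UNIV) f"
  have f: "bij_betw f (P.base \<times> UNIV) V" and h: "bij_betw h (Q.base \<times> UNIV) V"
    unfolding f_def h_def by (rule P.bij_betw_zpow Q.bij_betw_zpow)+
  have tf: "t (P.zpow n z) = Q.zpow n (\<tau> z)" if "z \<in> P.base" for n z
  proof -
    have "the_inv_into (P.base \<times> UNIV) f (f (z, n)) = (z, n)"
      using f that by (intro the_inv_into_f_f) (auto simp: bij_betw_def)
    then show ?thesis by (simp add: t_def f_def h_def)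
  qed
  have "bij_betw (map_prod \<tau> id) (P.base \<times> (UNIV :: int set)) (Q.base \<times> UNIV)"
    by (rule bij_betw_map_prod[OF \<tau> bij_betw_id])
  then have "bij_betw t V V"
    unfolding t_def using f h by (intro bij_betw_trans[OF bij_betw_the_inv_into]) (auto intro: bij_betw_trans)
  moreover have "t (p v) = q (t v)" if "v \<in> V" for v
  proof -
    have "v \<in> f ` (P.base \<times> UNIV)" by (subst bij_betw_imp_surj_on[OF f]) (rule that)
    then obtain z n where z: "z \<in> P.base" "v = P.zpow n z" by (auto simp: f_def)
    have "\<tau> z \<in> V" "z \<in> V" using z \<tau> Q.base_subset P.base_subset by (auto simp: bij_betw_def)
    then show ?thesis using z tf P.zpow_succ Q.zpow_succ by metis
  qed
  moreover have "t z = \<tau> z" if "z \<in> P.base" for z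
    using tf[OF that, of 0] by simp
  ultimately show ?thesis by blast
qed

section \<open>A weighted Schur test\<close>

lemma has_sum_finite_sum:
  fixes f :: "'i \<Rightarrow> 'a \<Rightarrow> real"
  assumes "finite I" "\<And>i. i \<in> I \<Longrightarrow> (f i has_sum a i) A"
  shows "((\<lambda>x. \<Sum>i\<in>I. f i x) has_sum (\<Sum>i\<in>I. a i)) A"
  using assms by (induction I) (auto intro: has_sum_add)

text \<open>Since \<open>\<omega> x s\<close> and the weight of the reversed edge are inverse to each other, Cauchy--Schwarz at
  every vertex costs one factor \<open>C\<close> and the summation over all edges costs the other.\<close>

lemma cayley_sum_square_bound:
  fixes f :: "'a \<Rightarrow> complex" and \<omega> :: "'a \<Rightarrow> 'a \<Rightarrow> real"
  assumes "group G" and S: "finite S" "S \<subseteq> carrier G" "\<And>s. s \<in> S \<Longrightarrow> inv\<^bsub>G\<^esub> s \<in> S"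
    and pos: "\<And>x s. x \<in> carrier G \<Longrightarrow> s \<in> S \<Longrightarrow> 0 < \<omega> x s"
    and recip: "\<And>x s. x \<in> carrier G \<Longrightarrow> s \<in> S \<Longrightarrow> \<omega> x s * \<omega> (x \<otimes>\<^bsub>G\<^esub> s) (inv\<^bsub>G\<^esub> s) = 1"
    and C: "\<And>x. x \<in> carrier G \<Longrightarrow> (\<Sum>s\<in>S. \<omega> x s) \<le> C" "0 \<le> C"
    and f: "f \<in> ell2 (carrier G)"
  defines "h \<equiv> \<lambda>x. (cmod (\<Sum>s\<in>S. f (x \<otimes>\<^bsub>G\<^esub> s)))\<^sup>2"
  shows "h summable_on carrier G"
    and "infsum h (carrier G) \<le> C\<^sup>2 * (\<Sum>\<^sub>\<infinity>x\<in>carrier G. (cmod (f x))\<^sup>2)"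
proof -
  interpret group G by fact
  define F where "F x = (cmod (f x))\<^sup>2" for x
  \<comment> \<open>For y = x s, reciprocity makes this the Cauchy--Schwarz term of the edge from x
    to y, written at its far end y.\<close>
  define e where "e s y = \<omega> y (inv\<^bsub>G\<^esub> s) * F y" for s y
  have F: "F summable_on carrier G"
    using f by (simp add: ell2_def F_def[abs_def])
  have \<omega>_le: "\<omega> x s \<le> C" if "x \<in> carrier G" "s \<in> S" for x s
    using member_le_sum[of s S "\<omega> x"] that S(1) pos C(1) by (meson less_eq_real_def order_trans DiffD1)
  have h_le: "h x \<le> C * (\<Sum>s\<in>S. e s (x \<otimes>\<^bsub>G\<^esub> s))" if x: "x \<in> carrier G" for x
  proof -
    have "h x \<le> (\<Sum>s\<in>S. cmod (f (x \<otimes>\<^bsub>G\<^esub> s)))\<^sup>2"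
      unfolding h_def by (intro power_mono norm_sum) auto
    also have "\<dots> = (\<Sum>s\<in>S. sqrt (\<omega> x s) * (cmod (f (x \<otimes>\<^bsub>G\<^esub> s)) / sqrt (\<omega> x s)))\<^sup>2"
      using pos[OF x] by (intro arg_cong[of _ _ "\<lambda>u. u\<^sup>2"] sum.cong) (force simp: less_le)+
    also have "\<dots> \<le> (\<Sum>s\<in>S. (sqrt (\<omega> x s))\<^sup>2) * (\<Sum>s\<in>S. (cmod (f (x \<otimes>\<^bsub>G\<^esub> s)) / sqrt (\<omega> x s))\<^sup>2)"
      by (rule Cauchy_Schwarz_ineq_sum)
    also have "\<dots> = (\<Sum>s\<in>S. \<omega> x s) * (\<Sum>s\<in>S. e s (x \<otimes>\<^bsub>G\<^esub> s))"
    proof (intro arg_cong2[of _ _ _ _ "(*)"] sum.cong refl)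
      fix s assume s: "s \<in> S"
      show "(sqrt (\<omega> x s))\<^sup>2 = \<omega> x s" using pos[OF x s] by simp
      have "\<omega> (x \<otimes>\<^bsub>G\<^esub> s) (inv\<^bsub>G\<^esub> s) = 1 / \<omega> x s"
        using recip[OF x s] pos[OF x s] by (simp add: field_simps)
      then show "(cmod (f (x \<otimes>\<^bsub>G\<^esub> s)) / sqrt (\<omega> x s))\<^sup>2 = e s (x \<otimes>\<^bsub>G\<^esub> s)"
        using pos[OF x s] by (simp add: e_def F_def power_divide)
    qed simp_all
    also have "\<dots> \<le> C * (\<Sum>s\<in>S. e s (x \<otimes>\<^bsub>G\<^esub> s))"
    proof (intro mult_right_mono C x sum_nonneg)
      fix s assume "s \<in> S"
      then show "0 \<le> e s (x \<otimes>\<^bsub>G\<^esub> s)"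
        using pos[of "x \<otimes>\<^bsub>G\<^esub> s" "inv\<^bsub>G\<^esub> s"] S x by (auto simp: e_def F_def)
    qed
    finally show ?thesis .
  qed
  have e_sum: "e s summable_on carrier G" if s: "s \<in> S" for s
    unfolding e_def
  proof (rule summable_on_comparison_test)
    show "(\<lambda>y. C * F y) summable_on carrier G" by (rule summable_on_cmult_right[OF F])
  qed (use s S pos \<omega>_le in \<open>auto simp: F_def less_le intro!: mult_right_mono\<close>)
  \<comment> \<open>Right translation by \<open>s\<close> regroups the sum at the far ends of the
    edges, where the weights again add up to at most \<open>C\<close>.\<close>
  have bij: "bij_betw (\<lambda>x. x \<otimes>\<^bsub>G\<^esub> s) (carrier G) (carrier G)" if "s \<in> S" for s
    by (rule bij_betw_byWitness[of _ "\<lambda>x. x \<otimes>\<^bsub>G\<^esub> inv\<^bsub>G\<^esub> s"]) (use that S in \<open>auto simp: m_assoc\<close>)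
  have "((\<lambda>x. e s (x \<otimes>\<^bsub>G\<^esub> s)) has_sum infsum (e s) (carrier G)) (carrier G)" if "s \<in> S" for s
    using has_sum_infsum[OF e_sum[OF that]] has_sum_reindex_bij_betw[OF bij[OF that]] by blast
  then have "((\<lambda>x. \<Sum>s\<in>S. e s (x \<otimes>\<^bsub>G\<^esub> s)) has_sum (\<Sum>s\<in>S. infsum (e s) (carrier G))) (carrier G)"
    using S(1) by (intro has_sum_finite_sum) auto
  then have E: "((\<lambda>x. C * (\<Sum>s\<in>S. e s (x \<otimes>\<^bsub>G\<^esub> s))) has_sum C * (\<Sum>s\<in>S. infsum (e s) (carrier G))) (carrier G)"
    by (rule has_sum_cmult_right)
  show h: "h summable_on carrier G"
    by (rule summable_on_comparison_test[OF has_sum_imp_summable[OF E] h_le]) (auto simp: h_def)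
  have "infsum h (carrier G) \<le> C * (\<Sum>s\<in>S. infsum (e s) (carrier G))"
    by (rule has_sum_mono[OF has_sum_infsum[OF h] E h_le])
  also have "(\<Sum>s\<in>S. infsum (e s) (carrier G)) \<le> C * infsum F (carrier G)"
  proof (rule has_sum_mono)
    show "((\<lambda>y. \<Sum>s\<in>S. e s y) has_sum (\<Sum>s\<in>S. infsum (e s) (carrier G))) (carrier G)"
      by (intro has_sum_finite_sum has_sum_infsum e_sum S)
    show "((\<lambda>y. C * F y) has_sum C * infsum F (carrier G)) (carrier G)"
      by (intro has_sum_cmult_right has_sum_infsum F)
    fix y assume y: "y \<in> carrier G"
    have "bij_betw (\<lambda>s. inv\<^bsub>G\<^esub> s) S S"
      by (rule bij_betw_byWitness[of _ "\<lambda>s. inv\<^bsub>G\<^esub> s"]) (use S in auto)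
    then have "(\<Sum>s\<in>S. \<omega> y (inv\<^bsub>G\<^esub> s)) = (\<Sum>s\<in>S. \<omega> y s)"
      by (rule sum.reindex_bij_betw)
    then have "(\<Sum>s\<in>S. e s y) = (\<Sum>s\<in>S. \<omega> y s) * F y"
      by (simp add: e_def flip: sum_distrib_right)
    also have "\<dots> \<le> C * F y"
      using C(1)[OF y] by (intro mult_right_mono) (auto simp: F_def)
    finally show "(\<Sum>s\<in>S. e s y) \<le> C * F y" .
  qed
  finally show "infsum h (carrier G) \<le> C\<^sup>2 * (\<Sum>\<^sub>\<infinity>x\<in>carrier G. (cmod (f x))\<^sup>2)"
    using C(2) by (simp add: F_def[abs_def] power2_eq_square mult.assoc mult_left_mono)
qed

text \<open>Right translates by distinct elements of \<open>S\<close> are distinct, so the neighbour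
  sum is a sum over \<open>S\<close>. The previous bound then makes \<open>C / card S\<close> one of
  the constants whose infimum is the operator norm.\<close>

lemma cayley_spectral_radius_le:
  fixes \<omega> :: "'a \<Rightarrow> 'a \<Rightarrow> real"
  assumes "group G" and S: "finite S" "S \<subseteq> carrier G" "\<And>s. s \<in> S \<Longrightarrow> inv\<^bsub>G\<^esub> s \<in> S"
    and pos: "\<And>x s. x \<in> carrier G \<Longrightarrow> s \<in> S \<Longrightarrow> 0 < \<omega> x s"
    and recip: "\<And>x s. x \<in> carrier G \<Longrightarrow> s \<in> S \<Longrightarrow> \<omega> x s * \<omega> (x \<otimes>\<^bsub>G\<^esub> s) (inv\<^bsub>G\<^esub> s) = 1"
    and C: "\<And>x. x \<in> carrier G \<Longrightarrow> (\<Sum>s\<in>S. \<omega> x s) \<le> C" "0 \<le> C"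
  shows "graph_spectral_radius (carrier G) (cayley_edges G S) \<le> C / card S"
proof -
  interpret group G by fact
  define T where "T = markov (cayley_edges G S)"
  have inj: "inj_on (\<lambda>s. x \<otimes>\<^bsub>G\<^esub> s) S" if "x \<in> carrier G" for x
    using that S(2) by (meson inj_on_cmult inj_on_subset)
  have T: "T f x = 1 / of_nat (card S) * (\<Sum>s\<in>S. f (x \<otimes>\<^bsub>G\<^esub> s))" if "x \<in> carrier G" for f x
    using inj[OF that] neighbours_cayley_edges[OF \<open>group G\<close> S(2,3) that]
    by (simp add: T_def markov_def card_image sum.reindex)
  have "T f \<in> ell2 (carrier G) \<and> ell2_norm (carrier G) (T f) \<le> C / card S * ell2_norm (carrier G) f"
    if f: "f \<in> ell2 (carrier G)" for f
  proof -
    define h where "h x = (cmod (\<Sum>s\<in>S. f (x \<otimes>\<^bsub>G\<^esub> s)))\<^sup>2" for x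
    have h: "h summable_on carrier G"
      "infsum h (carrier G) \<le> C\<^sup>2 * (\<Sum>\<^sub>\<infinity>x\<in>carrier G. (cmod (f x))\<^sup>2)"
      using cayley_sum_square_bound[OF assms f] by (simp_all add: h_def[abs_def])
    define r where "r = (1 / real (card S))\<^sup>2"
    have Th: "(cmod (T f x))\<^sup>2 = r * h x" if "x \<in> carrier G" for x
      by (simp add: T[OF that] h_def r_def norm_mult norm_divide power_mult_distrib power_divide)
    have "(\<lambda>x. (cmod (T f x))\<^sup>2) summable_on carrier G"
      using summable_on_cmult_right[OF h(1), of r] Th by (simp cong: summable_on_cong)
    moreover have "ell2_norm (carrier G) (T f) \<le> C / card S * ell2_norm (carrier G) f"
    proof -
      have "(\<Sum>\<^sub>\<infinity>x\<in>carrier G. (cmod (T f x))\<^sup>2) = r * infsum h (carrier G)"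
        using infsum_cmult_right[OF h(1), of r] Th by (simp cong: infsum_cong)
      also have "\<dots> \<le> r * (C\<^sup>2 * (\<Sum>\<^sub>\<infinity>x\<in>carrier G. (cmod (f x))\<^sup>2))"
        using h(2) by (intro mult_left_mono) (auto simp: r_def)
      also have "\<dots> = (C / card S)\<^sup>2 * (\<Sum>\<^sub>\<infinity>x\<in>carrier G. (cmod (f x))\<^sup>2)"
        by (simp add: r_def power_divide)
      finally show ?thesis
        using C(2) real_sqrt_le_mono unfolding ell2_norm_def
        by (metis abs_of_nonneg divide_nonneg_nonneg of_nat_0_le_iff real_sqrt_abs real_sqrt_mult)
    qed
    ultimately show ?thesis by (simp add: ell2_def)
  qed
  then show ?thesis
    unfolding graph_spectral_radius_def ell2_opnorm_def T_def[symmetric]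
    using C(2) by (intro cInf_lower) (auto intro: bdd_belowI[of _ 0])
qed

section \<open>Weights pulled back from a permutation representation\<close>

definition inv_letter :: "'a \<times> bool \<Rightarrow> 'a \<times> bool" where
  "inv_letter l = (fst l, \<not> snd l)"

lemma inv_letter_simps [simp]:
  "inv_letter (x, e) = (x, \<not> e)" "inv_letter (inv_letter l) = l" "fst (inv_letter l) = fst l"
  "snd (inv_letter l) \<longleftrightarrow> \<not> snd l" "inv_letter l \<noteq> l" "l \<noteq> inv_letter l"
  by (auto simp: inv_letter_def prod_eq_iff)

lemma inv_word_class_letter:
  assumes "x \<in> X"
  shows "inv\<^bsub>presented_group X R\<^esub> (word_class X R [(x, e)]) = word_class X R [(x, \<not> e)]"
proof (rule group.inv_equality[OF group_presented_group])
  have "word_eq X R ([] @ [(x, \<not> e), (x, \<not> \<not> e)] @ []) ([] @ [])"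
    using assms by (intro word_eq.cancel) auto
  then show "word_class X R [(x, \<not> e)] \<otimes>\<^bsub>presented_group X R\<^esub> word_class X R [(x, e)] =
      \<one>\<^bsub>presented_group X R\<^esub>"
    using assms by (simp add: mult_presented_group one_presented_group word_class_eq_iff)
qed (use assms in \<open>auto simp: carrier_presented_group\<close>)

lemma fold_act_in:
  assumes "\<And>l v. fst l \<in> X \<Longrightarrow> v \<in> V \<Longrightarrow> act l v \<in> V" "u \<in> words X" "v \<in> V"
  shows "fold act u v \<in> V"
  using assms(2,3) by (induction u arbitrary: v) (auto simp: assms(1))

text \<open>The action descends to the presented group. Since \<open>fold\<close> reads words from
  the left, it is a right action, matching the edges from x to x s of the Cayley graph.\<close>

lemma fold_act_word_eq:
  assumes act: "\<And>l v. fst l \<in> X \<Longrightarrow> v \<in> V \<Longrightarrow> act l v \<in> V"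
    and inv: "\<And>l v. fst l \<in> X \<Longrightarrow> v \<in> V \<Longrightarrow> act (inv_letter l) (act l v) = v"
    and rel: "\<And>r v. r \<in> R \<Longrightarrow> v \<in> V \<Longrightarrow> fold act r v = v"
    and "word_eq X R u w" "v \<in> V"
  shows "fold act u v = fold act w v"
proof -
  note V = fold_act_in[of X V act, OF act]
  show ?thesis
    using \<open>word_eq X R u w\<close> \<open>v \<in> V\<close>
  proof (induction arbitrary: v rule: word_eq.induct)
    case (cancel u w x e)
    then show ?case using inv[of "(x, e)" "fold act u v"] V by simp
  next
    case (relator u w r)
    then show ?case using rel V by simp
  qed auto
qed

text \<open>The orbit map of a point \<open>v0\<close> sends edges labelled by a letter to edges
  with the same label. All weight conditions concern a single vertex or a single edge, so they pull
  back even if the orbit map is not injective.\<close>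

lemma presented_group_spectral_radius_le:
  fixes act :: "'a \<times> bool \<Rightarrow> 'v \<Rightarrow> 'v" and \<omega> :: "'v \<Rightarrow> 'a \<times> bool \<Rightarrow> real"
  assumes X: "finite X" and inj: "inj_on (\<lambda>l. word_class X R [l]) (X \<times> UNIV)" and "V \<noteq> {}"
    and act: "\<And>l v. fst l \<in> X \<Longrightarrow> v \<in> V \<Longrightarrow> act l v \<in> V"
    and inv: "\<And>l v. fst l \<in> X \<Longrightarrow> v \<in> V \<Longrightarrow> act (inv_letter l) (act l v) = v"
    and rel: "\<And>r v. r \<in> R \<Longrightarrow> v \<in> V \<Longrightarrow> fold act r v = v"
    and pos: "\<And>l v. fst l \<in> X \<Longrightarrow> v \<in> V \<Longrightarrow> 0 < \<omega> v l"
    and recip: "\<And>l v. fst l \<in> X \<Longrightarrow> v \<in> V \<Longrightarrow> \<omega> v l * \<omega> (act l v) (inv_letter l) = 1"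
    and C: "\<And>v. v \<in> V \<Longrightarrow> (\<Sum>l\<in>X \<times> UNIV. \<omega> v l) \<le> C" "0 \<le> C"
  defines "S \<equiv> (\<lambda>l. word_class X R [l]) ` (X \<times> UNIV)"
  shows "graph_spectral_radius (carrier (presented_group X R)) (cayley_edges (presented_group X R) S)
           \<le> C / (2 * card X)"
proof -
  let ?G = "presented_group X R" and ?c = "\<lambda>l. word_class X R [l]"
  obtain v0 where v0: "v0 \<in> V" using \<open>V \<noteq> {}\<close> by auto
  define pos_of where "pos_of P = fold act (SOME u. u \<in> words X \<and> P = word_class X R u) v0" for P
  define letter where "letter = the_inv_into (X \<times> UNIV) ?c"
  have letter: "letter (?c l) = l" if "l \<in> X \<times> UNIV" for l
    unfolding letter_def by (rule the_inv_into_f_f[OF inj that])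
  have pos_of: "pos_of (word_class X R u) = fold act u v0" if u: "u \<in> words X" for u
  proof -
    define w where "w = (SOME w. w \<in> words X \<and> word_class X R u = word_class X R w)"
    have "w \<in> words X \<and> word_class X R u = word_class X R w"
      unfolding w_def by (rule someI[of _ u]) (use u in auto)
    then have "word_eq X R w u" using u word_class_eq_iff by metis
    then show ?thesis
      unfolding pos_of_def w_def[symmetric] using fold_act_word_eq[OF act inv rel _ v0] by blast
  qed
  have "graph_spectral_radius (carrier ?G) (cayley_edges ?G S) \<le> C / card S"
  proof (rule cayley_spectral_radius_le[where \<omega> = "\<lambda>P s. \<omega> (pos_of P) (letter s)"])
    show "group ?G" by (rule group_presented_group)
    show "finite S" using X by (simp add: S_def)
    show "S \<subseteq> carrier ?G" by (auto simp: S_def carrier_presented_group)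
    show "inv\<^bsub>?G\<^esub> s \<in> S" if "s \<in> S" for s
      using that by (auto simp: S_def inv_word_class_letter)
    show "0 \<le> C" by fact
  next
    fix P assume "P \<in> carrier ?G"
    then obtain u where u: "u \<in> words X" "P = word_class X R u"
      by (auto simp: carrier_presented_group)
    have v: "pos_of P \<in> V" using fold_act_in[of X V act, OF act u(1) v0] u pos_of by simp
    have "(\<Sum>s\<in>S. \<omega> (pos_of P) (letter s)) = (\<Sum>l\<in>X \<times> UNIV. \<omega> (pos_of P) l)"
      unfolding S_def using inj letter by (simp add: sum.reindex)
    then show "(\<Sum>s\<in>S. \<omega> (pos_of P) (letter s)) \<le> C" using C(1)[OF v] by simp
    fix s assume "s \<in> S"
    then obtain x e where l: "x \<in> X" "s = ?c (x, e)" by (auto simp: S_def)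
    show "0 < \<omega> (pos_of P) (letter s)" using l pos[of "(x, e)" "pos_of P"] v letter by simp
    have "pos_of (P \<otimes>\<^bsub>?G\<^esub> s) = act (x, e) (pos_of P)"
      using u l pos_of by (simp add: mult_presented_group)
    then show "\<omega> (pos_of P) (letter s) * \<omega> (pos_of (P \<otimes>\<^bsub>?G\<^esub> s)) (letter (inv\<^bsub>?G\<^esub> s)) = 1"
      using l v letter recip[of "(x, e)" "pos_of P"] by (simp add: inv_word_class_letter)
  qed
  moreover have "card S = 2 * card X"
    unfolding S_def by (simp add: card_image[OF inj] card_cartesian_product)
  ultimately show ?thesis by simp
qed

section \<open>Free reduction and the choice of base points\<close>

definition reduced :: "'a word \<Rightarrow> bool" where
  "reduced = successively (\<lambda>k l. l \<noteq> inv_letter k)"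

text \<open>Words are stored in reverse: \<open>push l f\<close> is the reduced form of the word \<open>f\<close> followed by \<open>l\<close>,
  and the last letter of the word is \<open>hd f\<close>.\<close>

definition push :: "'a \<times> bool \<Rightarrow> 'a word \<Rightarrow> 'a word" where
  "push l f = (if f \<noteq> [] \<and> hd f = inv_letter l then tl f else l # f)"

lemma inv_letter_eq_iff: "inv_letter k = l \<longleftrightarrow> k = inv_letter l"
  by auto

lemma reduced_Nil [simp]: "reduced []"
  by (simp add: reduced_def)

lemma reduced_Cons: "reduced (l # f) \<longleftrightarrow> reduced f \<and> (f \<noteq> [] \<longrightarrow> hd f \<noteq> inv_letter l)"
  by (auto simp: reduced_def successively_Cons)

lemma reduced_append:
  "reduced (f @ h) \<longleftrightarrow> reduced f \<and> reduced h \<and> (f \<noteq> [] \<longrightarrow> h \<noteq> [] \<longrightarrow> hd h \<noteq> inv_letter (last f))"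
  by (auto simp: reduced_def successively_append_iff)

lemma reduced_rev: "reduced (rev f) \<longleftrightarrow> reduced f"
  unfolding reduced_def successively_rev by (intro arg_cong2[of _ _ _ _ successively] refl ext) auto

lemma reduced_map_inv: "reduced (map inv_letter f) \<longleftrightarrow> reduced f"
  by (induction f) (auto simp: reduced_Cons hd_map inv_letter_eq_iff)

lemma reduced_push: "reduced f \<Longrightarrow> reduced (push l f)"
  by (cases f) (auto simp: push_def reduced_Cons)

lemma reduced_fold_push: "reduced f \<Longrightarrow> reduced (fold push x f)"
  by (induction x arbitrary: f) (auto simp: reduced_push)

lemma push_inv_letter: "reduced f \<Longrightarrow> push (inv_letter l) (push l f) = f"
  by (cases f) (auto simp: push_def reduced_Cons split: list.splits)

lemma push_inv_letter': "reduced f \<Longrightarrow> push l (push (inv_letter l) f) = f"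
  using push_inv_letter[of f "inv_letter l"] by simp

lemma word_inv_eq: "word_inv u = rev (map inv_letter u)"
  by (simp add: word_inv_def inv_letter_def case_prod_unfold)

lemma fold_push_word_inv: "reduced f \<Longrightarrow> fold push (word_inv x) (fold push x f) = f"
  by (induction x arbitrary: f) (auto simp: word_inv_eq push_inv_letter reduced_push)

lemma fold_push_word_inv': "reduced f \<Longrightarrow> fold push x (fold push (word_inv x) f) = f"
  using fold_push_word_inv[of f "word_inv x"] by (simp add: word_inv_eq rev_map comp_def)

lemma fold_push_reduced: "reduced (rev x @ f) \<Longrightarrow> fold push x f = rev x @ f"
proof (induction x arbitrary: f)
  case (Cons a x)
  then have "push a f = a # f" by (auto simp: push_def reduced_append reduced_Cons)
  then show ?case using Cons by simp
qed simp

text \<open>In reversed storage \<open>map inv_letter W @ f\<close> is a word ending with the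
  inverse of \<open>W\<close>.\<close>

lemma fold_push_cancel:
  "fold push W (map inv_letter W @ f) = f"
  by (induction W) (auto simp: push_def)

text \<open>If cancellation stops before \<open>W\<close> is used up, every remaining letter of
  \<open>W\<close> is kept, in particular the last one.\<close>

lemma fold_push_partial_cancel:
  assumes "reduced W" "reduced f"
  shows "prefix (map inv_letter W) f \<or> (\<exists>h. fold push W f = last W # h)"
  using assms
proof (induction W arbitrary: f)
  case (Cons a W)
  show ?case
  proof (cases "f \<noteq> [] \<and> hd f = inv_letter a")
    case True
    then obtain f' where f: "f = inv_letter a # f'" by (cases f) auto
    show ?thesis
      using Cons.IH[of f'] Cons.prems by (auto simp: f push_def reduced_Cons)
  next
    case False
    then have "reduced (rev (a # W) @ f)"
      using Cons.prems by (auto simp: reduced_append reduced_rev reduced_Cons last_rev)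
    then have "fold push (a # W) f = rev (a # W) @ f" by (rule fold_push_reduced)
    then show ?thesis by (metis append_Cons list.exhaust list.discI hd_append hd_rev list.sel(1) rev_is_Nil_conv)
  qed
qed simp

text \<open>The \<open>u\<close>-lines and \<open>b\<close>-lines are the orbits of right multiplication by \<open>u = W\<inverse> b\<close> and by \<open>b\<close>; the HNN
  extension with \<open>s b s\<inverse> = u\<close> is built on them. The base points of the \<open>b\<close>-lines are not the points
  nearest to the empty word: at words ending with \<open>W\<inverse>\<close> they are shifted, so that every word is a base
  point of at least one of its two lines.\<close>

locale hnn_word =
  fixes W :: "'a word" and b :: "'a \<times> bool"
  assumes reduced_W: "reduced W" and W_ne: "W \<noteq> []" and W_cyc: "inv_letter (hd W) \<noteq> last W"
    and b_notin: "fst b \<notin> fst ` set W"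
begin

definition u_pos :: "'a word set" where
  "u_pos = {f. prefix (b # map inv_letter W) f}"

definition u_neg :: "'a word set" where
  "u_neg = {f. f \<noteq> [] \<and> hd f = last W}"

text \<open>For a word w ending with W^-1, the natural origin w of its b-line is moved to w b. The
  latter lies in \<open>u_pos\<close>, so it is not a base point of its u-line and has to be one
  here.\<close>

definition b_pos :: "'a word set" where
  "b_pos = {f. f \<noteq> [] \<and> hd f = b} - u_pos"

definition b_neg :: "'a word set" where
  "b_neg = {f. f \<noteq> [] \<and> hd f = inv_letter b} \<union> {f. prefix (map inv_letter W) f}"

lemma W_letters: "l \<in> set W \<Longrightarrow> l \<noteq> b \<and> l \<noteq> inv_letter b \<and> inv_letter l \<noteq> b \<and> inv_letter l \<noteq> inv_letter b"
  using b_notin by (metis imageI inv_letter_simps(2,3))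

lemma hd_last_W: "hd W \<in> set W" "last W \<in> set W"
  using W_ne by auto

lemma prefix_hd: "prefix (map inv_letter W) f \<Longrightarrow> f \<noteq> [] \<and> hd f = inv_letter (hd W)"
  using W_ne by (auto simp: prefix_def hd_map hd_append)

lemma u_pos_hd: "f \<in> u_pos \<Longrightarrow> f \<noteq> [] \<and> hd f = b"
  by (auto simp: u_pos_def prefix_def)

text \<open>Appending u = W^-1 b cancels nothing unless the word ends with \<open>last W\<close>;
  appending u^-1 = b^-1 W leaves \<open>last W\<close> at the end unless the whole of u is
  cancelled.\<close>

lemma line_perm_u:
  "line_perm {f. reduced f} (fold push (word_inv W @ [b])) (fold push (inv_letter b # W)) u_pos u_neg length"
proof
  note lW = W_letters[OF hd_last_W(1)] W_letters[OF hd_last_W(2)]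
  have u_back: "fold push (inv_letter b # W) (fold push (word_inv W @ [b]) f) = f" if "reduced f" for f
    using that by (simp add: push_inv_letter reduced_fold_push fold_push_word_inv')
  show "fold push (inv_letter b # W) (fold push (word_inv W @ [b]) f) = f"
    if "f \<in> {f. reduced f}" for f using that u_back by simp
  show "fold push (word_inv W @ [b]) (fold push (inv_letter b # W) f) = f"
    if "f \<in> {f. reduced f}" for f
    using that by (simp add: push_inv_letter' reduced_push fold_push_word_inv)
  show "fold push (word_inv W @ [b]) f \<in> {f. reduced f}" if "f \<in> {f. reduced f}" for f
    using that by (simp add: reduced_fold_push reduced_push)
  show "fold push (inv_letter b # W) f \<in> {f. reduced f}" if "f \<in> {f. reduced f}" for f
    using that by (simp add: reduced_fold_push reduced_push)
  show "u_pos \<inter> u_neg = {}"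
    using lW u_pos_hd by (fastforce simp: u_neg_def)
  show "fold push (word_inv W @ [b]) f \<in> u_pos" if "f \<in> {f. reduced f}" "f \<notin> u_neg" for f
  proof -
    have "reduced (rev (word_inv W @ [b]) @ f)"
      using that lW W_ne reduced_W
      by (auto simp: word_inv_eq reduced_append reduced_Cons reduced_map_inv u_neg_def last_map hd_map hd_append)
    from fold_push_reduced[OF this] show ?thesis
      by (simp add: u_pos_def word_inv_eq)
  qed
  show "fold push (inv_letter b # W) f \<in> u_neg" if "f \<in> {f. reduced f}" "f \<notin> u_pos" for f
  proof -
    have "\<not> prefix (map inv_letter W) (push (inv_letter b) f)"
      using that lW prefix_hd[of "push (inv_letter b) f"]
      by (cases f) (auto simp: push_def u_pos_def split: if_splits)
    then show ?thesis
      using fold_push_partial_cancel[OF reduced_W, of "push (inv_letter b) f"] that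
      by (auto simp: u_neg_def reduced_push)
  qed
  show "fold push (inv_letter b # W) f \<notin> u_pos \<union> u_neg \<or> length (fold push (inv_letter b # W) f) < length f"
    if f: "f \<in> {f. reduced f}" "f \<in> u_pos" for f
  proof -
    obtain h where h: "f = b # map inv_letter W @ h" using f by (auto simp: u_pos_def prefix_def)
    have "fold push (inv_letter b # W) f = h" by (simp add: h push_def fold_push_cancel)
    then show ?thesis by (simp add: h)
  qed
  show "fold push (word_inv W @ [b]) f \<notin> u_pos \<union> u_neg \<or> length (fold push (word_inv W @ [b]) f) < length f"
    if f: "f \<in> {f. reduced f}" "f \<in> u_neg" for f
  proof -
    define k where "k = fold push (word_inv W @ [b]) f"
    have kf: "fold push (inv_letter b # W) k = f" using u_back f by (simp add: k_def)
    have rk: "reduced k" using f by (simp add: k_def reduced_fold_push reduced_push)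
    consider "k \<notin> u_pos \<union> u_neg" | "k \<in> u_pos" | "k \<in> u_neg" by blast
    then show ?thesis
    proof cases
      case 2
      then obtain h where h: "k = b # map inv_letter W @ h" by (auto simp: u_pos_def prefix_def)
      have "f = h" using kf by (simp add: h push_def fold_push_cancel)
      \<comment> \<open>The first letter of W^-1 would directly follow its inverse
        \<open>last W\<close> in the reduced word \<open>k\<close>.\<close>
      then have False
        using rk f W_ne by (auto simp: h u_neg_def reduced_Cons reduced_append last_map)
      then show ?thesis ..
    next
      case 3
      then have k: "k \<noteq> []" "hd k = last W" by (auto simp: u_neg_def)
      then have "reduced (rev W @ inv_letter b # k)"
        using rk reduced_W lW by (auto simp: reduced_append reduced_Cons reduced_rev last_rev)
      then have "f = rev W @ inv_letter b # k"
        using kf fold_push_reduced[of W "inv_letter b # k"] k lW by (simp add: push_def)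
      then have "length k < length f" by simp
      then show ?thesis unfolding k_def by blast
    qed (simp add: k_def)
  qed
qed

lemma line_perm_b:
  "line_perm {f. reduced f} (push b) (push (inv_letter b)) b_pos b_neg length"
proof
  note lW = W_letters[OF hd_last_W(1)] W_letters[OF hd_last_W(2)]
  show "push (inv_letter b) (push b f) = f" "push b (push (inv_letter b) f) = f"
    "push b f \<in> {f. reduced f}" "push (inv_letter b) f \<in> {f. reduced f}" if "f \<in> {f. reduced f}" for f
    using that by (simp_all add: push_inv_letter push_inv_letter' reduced_push)
  show "b_pos \<inter> b_neg = {}"
    using lW prefix_hd by (fastforce simp: b_pos_def b_neg_def)
  show "push b f \<in> b_pos" if "f \<in> {f. reduced f}" "f \<notin> b_neg" for f
    using that by (auto simp: push_def b_pos_def b_neg_def u_pos_def)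
  show "push (inv_letter b) f \<in> b_neg" if "f \<in> {f. reduced f}" "f \<notin> b_pos" for f
  proof (cases "f \<in> u_pos")
    case True
    then show ?thesis by (auto simp: push_def b_neg_def u_pos_def prefix_def)
  next
    case False
    then show ?thesis using that by (auto simp: push_def b_pos_def b_neg_def)
  qed
  show "push (inv_letter b) f \<notin> b_pos \<union> b_neg \<or> length (push (inv_letter b) f) < length f"
    if "f \<in> {f. reduced f}" "f \<in> b_pos" for f
    using that by (auto simp: push_def b_pos_def)
  show "push b f \<notin> b_pos \<union> b_neg \<or> length (push b f) < length f"
    if "f \<in> {f. reduced f}" "f \<in> b_neg" for f
  proof (cases "hd f = inv_letter b \<and> f \<noteq> []")
    case False
    \<comment> \<open>Appending b lengthens the word here, but it produces the shifted
      origin.\<close>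
    then have "prefix (map inv_letter W) f" using that by (auto simp: b_neg_def)
    moreover have "\<not> prefix (map inv_letter W) (b # f)" using prefix_hd lW by fastforce
    ultimately show ?thesis
      using False by (auto simp: push_def b_pos_def b_neg_def u_pos_def)
  qed (auto simp: push_def)
qed

text \<open>A word that is not a base point of its b-line ends with b, b^-1 or the inverse of
  \<open>hd W\<close>. None of these is \<open>last W\<close>, by \<open>W_cyc\<close> for the
  third, and \<open>u_pos\<close> is disjoint from both \<open>b_pos\<close> and
  \<open>b_neg\<close>.\<close>

lemma b_or_u_base: "f \<notin> u_pos \<union> u_neg \<or> f \<notin> b_pos \<union> b_neg"
  using W_letters[OF hd_last_W(1)] W_letters[OF hd_last_W(2)] W_cyc prefix_hd[of f] u_pos_hd[of f]
  by (auto simp: b_pos_def b_neg_def u_neg_def)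

lemma base_if_hd_notin:
  assumes "f = [] \<or> fst (hd f) \<notin> insert (fst b) (fst ` set W)"
  shows "f \<notin> u_pos \<union> u_neg \<union> b_pos \<union> b_neg"
  using assms hd_last_W prefix_hd[of f] W_ne
  by (fastforce simp: b_pos_def b_neg_def u_pos_def u_neg_def prefix_def)

end

section \<open>Pairing of base points and construction of the stable letter\<close>

lemma reduced_replicate: "reduced (replicate n l)"
  by (induction n) (auto simp: reduced_Cons hd_replicate)

lemma infinite_reduced_hd: "infinite {f. reduced f \<and> f \<noteq> [] \<and> hd f = l}"
proof -
  have "range (\<lambda>n. replicate (Suc n) l) \<subseteq> {f. reduced f \<and> f \<noteq> [] \<and> hd f = l}"
    using reduced_replicate[of "Suc _" l] by fastforce
  moreover have "inj (\<lambda>n. replicate (Suc n) l)"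
    by (rule injI) (metis Suc_inject length_replicate)
  ultimately show ?thesis
    using finite_subset range_inj_infinite by blast
qed

text \<open>Four countably infinite pieces are matched crosswise. With sets of roots for
  \<open>P\<close> and \<open>Q\<close>, each pair has either its first member in \<open>P\<close>
  or its second in \<open>Q\<close>, never both.\<close>

lemma ex_bij_betw_countable_split:
  assumes "countable A" "countable B" "P \<subseteq> A" "Q \<subseteq> B"
    and "infinite P" "infinite (A - P)" "infinite Q" "infinite (B - Q)"
  shows "\<exists>\<tau>. bij_betw \<tau> A B \<and> \<tau> ` P = B - Q \<and> \<tau> ` (A - P) = Q"
proof -
  have ex: "\<exists>h. bij_betw h C D" if "countable C" "infinite C" "countable D" "infinite D"
    for C :: "'a set" and D :: "'b set"
    using bij_betw_trans[OF to_nat_on_infinite[OF that(1,2)] bij_betw_from_nat_into[OF that(3,4)]] by blast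
  obtain h where h: "bij_betw h P (B - Q)"
    using ex[of P "B - Q"] assms countable_subset by (metis Diff_subset)
  obtain k where k: "bij_betw k (A - P) Q"
    using ex[of "A - P" Q] assms countable_subset by (metis Diff_subset)
  define \<tau> where "\<tau> x = (if x \<in> P then h x else k x)" for x
  have h': "bij_betw \<tau> P (B - Q)"
    using h by (rule bij_betw_cong[THEN iffD1, rotated]) (simp add: \<tau>_def)
  have k': "bij_betw \<tau> (A - P) Q"
    using k by (rule bij_betw_cong[THEN iffD1, rotated]) (simp add: \<tau>_def)
  have "bij_betw \<tau> (P \<union> (A - P)) ((B - Q) \<union> Q)"
    by (rule bij_betw_combine[OF h' k']) auto
  moreover have "P \<union> (A - P) = A" "(B - Q) \<union> Q = B" using assms by auto
  ultimately show ?thesis using h' k' by (metis bij_betw_imp_surj_on)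
qed

context hnn_word
begin

definition u_base :: "'a word set" where
  "u_base = {f. reduced f} - (u_pos \<union> u_neg)"

definition b_base :: "'a word set" where
  "b_base = {f. reduced f} - (b_pos \<union> b_neg)"

text \<open>The stable letter maps the \<open>u\<close>-line of \<open>z\<close> onto the \<open>b\<close>-line of \<open>\<tau> z\<close>. The words ending with the
  unused letter \<open>c\<close> serve as infinitely many roots of further trees: \<open>\<tau>\<close> is chosen such that every
  edge between base points contains a root, from which it can be oriented outwards.\<close>

lemma ex_stable_letter:
  fixes c
  assumes "countable (UNIV :: 'a set)" and c: "c \<notin> insert (fst b) (fst ` set W)"
  defines "V \<equiv> {f. reduced f}"
    and "P \<equiv> {f. reduced f \<and> f \<noteq> [] \<and> hd f = (c, True)}"
    and "Q \<equiv> {f. reduced f \<and> f \<noteq> [] \<and> hd f = (c, False)}"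
  shows "\<exists>t. bij_betw t V V \<and> (\<forall>v\<in>V. t (push b (fold push (word_inv W) v)) = push b (t v)) \<and>
    t ` P = b_base - Q \<and> t ` (u_base - P) = Q \<and> t ` (V - u_base) = V - b_base"
proof -
  have V: "countable V"
  proof -
    have "countable (UNIV :: ('a \<times> bool) set)"
      using countable_SIGMA[OF assms(1), of "\<lambda>_. UNIV :: bool set"]
      by (simp add: UNIV_Times_UNIV[symmetric] del: UNIV_Times_UNIV)
    then have "countable (UNIV :: 'a word set)"
      using countable_lists[of "UNIV :: ('a \<times> bool) set"] by simp
    then show ?thesis using countable_subset subset_UNIV by blast
  qed
  have base: "line_perm.base V u_pos u_neg = u_base" "line_perm.base V b_pos b_neg = b_base"
    unfolding V_def u_base_def b_base_def
    by (rule line_perm.base_def[OF line_perm_u] line_perm.base_def[OF line_perm_b])+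
  have sub: "P \<union> Q \<subseteq> u_base" "P \<union> Q \<subseteq> b_base"
    using base_if_hd_notin c by (auto simp: P_def Q_def u_base_def b_base_def)
  have disj: "P \<inter> Q = {}" by (auto simp: P_def Q_def)
  have inf: "infinite P" "infinite Q" unfolding P_def Q_def by (rule infinite_reduced_hd)+
  have "\<exists>\<tau>. bij_betw \<tau> u_base b_base \<and> \<tau> ` P = b_base - Q \<and> \<tau> ` (u_base - P) = Q"
  proof (rule ex_bij_betw_countable_split)
    show "countable u_base" "countable b_base"
      using V by (auto simp: u_base_def b_base_def V_def)
    \<comment> \<open>Both root sets lie in both bases, so each makes the complement of the other
      infinite.\<close>
    have "Q \<subseteq> u_base - P" "P \<subseteq> b_base - Q" using sub disj by auto
    then show "infinite (u_base - P)" "infinite (b_base - Q)" using inf infinite_super by blast+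
  qed (use sub inf in auto)
  then obtain \<tau> where \<tau>: "bij_betw \<tau> u_base b_base" "\<tau> ` P = b_base - Q" "\<tau> ` (u_base - P) = Q"
    by blast
  obtain t where t: "bij_betw t V V"
      "\<forall>v\<in>V. t (fold push (word_inv W @ [b]) v) = push b (t v)" "\<forall>z\<in>u_base. t z = \<tau> z"
    using line_perm_conjugator[OF line_perm_u line_perm_b] \<tau>(1) base unfolding V_def by metis
  have im: "t ` Z = \<tau> ` Z" if "Z \<subseteq> u_base" for Z
    using t(3) that by (intro image_cong) auto
  have "t ` (V - u_base) = t ` V - t ` u_base"
    using t(1) by (intro inj_on_image_set_diff[of t V]) (auto simp: bij_betw_def u_base_def V_def)
  also have "\<dots> = V - b_base"
    using t(1) im[of u_base] \<tau>(1) by (simp add: bij_betw_def)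
  finally show ?thesis
    using t im[of P] im[of "u_base - P"] \<tau> sub by (intro exI[of _ t]) auto
qed

text \<open>The weight of an edge is \<open>\<kappa>\<close> towards the parent, \<open>1 / \<kappa>\<close> towards a child and \<open>1\<close> on the edges of
  the stable letter that do not join base points; every vertex has at most one parent and, by
  \<open>b_or_u_base\<close>, at most one edge of weight \<open>1\<close>.\<close>

theorem one_relator_spectral_radius_le:
  assumes X: "finite X" "fst ` set W \<subseteq> X - {s}" "fst b \<in> X - {s}" "s \<in> X"
    and "countable (UNIV :: 'a set)" "c \<notin> X"
    and inj: "inj_on (\<lambda>l. word_class X {[(s, True), b, (s, False), inv_letter b] @ W} [l]) (X \<times> UNIV)"
  defines "R \<equiv> {[(s, True), b, (s, False), inv_letter b] @ W}"
  shows "graph_spectral_radius (carrier (presented_group X R))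
      (cayley_edges (presented_group X R) ((\<lambda>l. word_class X R [l]) ` (X \<times> UNIV)))
    \<le> (2 * sqrt (2 * card X - 2) + 1) / (2 * card X)"
proof -
  define V where "V = {f :: 'a word. reduced f}"
  define P where "P = {f. reduced f \<and> f \<noteq> [] \<and> hd f = (c, True)}"
  define Q where "Q = {f. reduced f \<and> f \<noteq> [] \<and> hd f = (c, False)}"
  have c: "c \<notin> insert (fst b) (fst ` set W)" using X(2,3) \<open>c \<notin> X\<close> by blast
  from ex_stable_letter[OF assms(5) c, folded V_def P_def Q_def] obtain t where t: "bij_betw t V V"
      "\<forall>v\<in>V. t (push b (fold push (word_inv W) v)) = push b (t v)"
      "t ` P = b_base - Q" "t ` (u_base - P) = Q" "t ` (V - u_base) = V - b_base"
    by (elim exE conjE)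
  define t' where "t' = the_inv_into V t"
  have t_in: "t v \<in> V" and t'_in: "t' v \<in> V" and t't: "t' (t v) = v" and tt': "t (t' v) = v"
    if "v \<in> V" for v
    using that t(1) bij_betw_the_inv_into[OF t(1)] unfolding t'_def
    by (auto simp: bij_betw_def the_inv_into_f_f f_the_inv_into_f)
  have sub: "P \<subseteq> u_base" "Q \<subseteq> b_base" "P \<inter> Q = {}"
    using base_if_hd_notin c by (auto simp: P_def Q_def u_base_def b_base_def)
  \<comment> \<open>This value minimises \<kappa> + n / \<kappa>, where n = 2 * card X - 2 counts
    the letters other than s and s^-1.\<close>
  define \<kappa> where "\<kappa> = sqrt (2 * card X - 2)"
  define L where "L = (X - {s}) \<times> (UNIV :: bool set)"
  have "card (X - {s}) > 0" using X by (metis card_gt_0_iff empty_iff finite_Diff)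
  moreover have cX: "card X = Suc (card (X - {s}))"
    using X by (metis card_Suc_Diff1)
  ultimately have "\<kappa> \<ge> 1" by (simp add: \<kappa>_def)
  then have \<kappa>: "\<kappa> > 0" "1 / \<kappa> \<le> 1" by auto
  then have \<kappa>_inv: "1 / \<kappa> \<le> \<kappa>" "2 / \<kappa> \<le> \<kappa> + 1"
    using \<open>\<kappa> \<ge> 1\<close> by linarith+
  have \<kappa>2: "real (card L) = \<kappa> * \<kappa>"
    using cX by (simp add: \<kappa>_def L_def card_cartesian_product)
  define act where "act l v = (if fst l \<noteq> s then push l v else if snd l then t v else t' v)" for l v
  \<comment> \<open>As \<open>c\<close> is not in \<open>X\<close>, words ending with c or c^-1 have
    no parent in the forest and may take one along the stable letter: \<open>P\<close> along s,
    \<open>Q\<close> along s^-1.\<close>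
  define \<omega> where "\<omega> v l =
    (if fst l \<noteq> s then (if v \<noteq> [] \<and> hd v = inv_letter l then \<kappa> else 1 / \<kappa>)
     else if snd l then (if v \<in> P then \<kappa> else if v \<in> u_base then 1 / \<kappa> else 1)
     else (if v \<in> Q then \<kappa> else if v \<in> b_base then 1 / \<kappa> else 1))" for v l
  have act_W: "fold act W v = fold push W v" for v
    using X(2) by (intro fold_cong) (force simp: act_def fun_eq_iff)+
  have t_weight: "\<omega> v (s, True) * \<omega> (t v) (s, False) = 1" if v: "v \<in> V" for v
  proof -
    consider "v \<in> P" "t v \<in> b_base - Q" | "v \<in> u_base - P" "t v \<in> Q" | "v \<in> V - u_base" "t v \<in> V - b_base"
      using v t(3-5) by blast
    then show ?thesis using \<kappa> sub by cases (auto simp: \<omega>_def)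
  qed
  have act_rel: "fold act r v = v" if "r \<in> R" and v: "v \<in> V" for r v
  proof -
  from that have r: "r = [(s, True), b, (s, False), inv_letter b] @ W" by (simp add: R_def)
  let ?w = "fold push (word_inv W) v"
  have w: "reduced ?w" using v by (simp add: V_def reduced_fold_push)
  then have "push b ?w \<in> V" by (simp add: V_def reduced_push)
  \<comment> \<open>By equivariance of \<open>t\<close>, the letters s, b, s^-1 together act as u =
    W^-1 b, which b^-1 W then undoes.\<close>
  then have "fold act r v = fold push W (push (inv_letter b) (push b ?w))"
    using X v t(2)[THEN bspec, OF v, symmetric] by (simp add: r act_W) (simp add: act_def t't)
  also have "\<dots> = v"
    using v w by (simp add: V_def push_inv_letter fold_push_word_inv')
  finally show ?thesis .
  qed
  have act_in: "act l v \<in> V" if v: "v \<in> V" for l v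
    using v t_in t'_in by (auto simp: act_def V_def reduced_push)
  have act_inv: "act (inv_letter l) (act l v) = v" if v: "v \<in> V" for l v
    using v t't tt' by (auto simp: act_def V_def push_inv_letter)
  have pos: "0 < \<omega> v l" for l v using \<kappa> by (auto simp: \<omega>_def)
  have recip: "\<omega> v l * \<omega> (act l v) (inv_letter l) = 1" if v: "v \<in> V" for l v
  proof (cases "fst l = s")
    case True
    then consider "l = (s, True)" | "l = (s, False)" by (metis (full_types) prod.collapse)
    then show ?thesis
      using t_weight[OF v] t_weight[OF t'_in[OF v]] tt'[OF v]
      by cases (auto simp: act_def mult.commute)
  next
    case False
    then show ?thesis
      using v \<kappa> by (cases v) (auto simp: \<omega>_def act_def push_def V_def reduced_Cons inv_letter_eq_iff)
  qed
  have weight_sum: "(\<Sum>l\<in>X \<times> UNIV. \<omega> v l) \<le> 2 * \<kappa> + 1" if v: "v \<in> V" for v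
  proof -
    have "X \<times> UNIV = insert (s, True) (insert (s, False) L)"
      using X by (auto simp: L_def)
    moreover have "finite L" using X by (simp add: L_def)
    ultimately have split: "(\<Sum>l\<in>X \<times> UNIV. \<omega> v l) = \<omega> v (s, True) + \<omega> v (s, False) + (\<Sum>l\<in>L. \<omega> v l)"
      by (simp add: L_def)
    show ?thesis
    proof (cases "v \<noteq> [] \<and> hd v \<in> L")
      case True
      \<comment> \<open>Deleting the last letter leads to the parent in the forest.\<close>
      let ?k = "inv_letter (hd v)"
      have k: "?k \<in> L" using True by (cases "hd v") (auto simp: L_def)
      have "(\<Sum>l\<in>L. \<omega> v l) = \<omega> v ?k + (\<Sum>l\<in>L - {?k}. \<omega> v l)"
        using k \<open>finite L\<close> by (rule sum.remove[rotated])
      also have "(\<Sum>l\<in>L - {?k}. \<omega> v l) = (\<Sum>l\<in>L - {?k}. 1 / \<kappa>)"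
        by (intro sum.cong) (auto simp: \<omega>_def L_def)
      also have "\<dots> = (\<kappa> * \<kappa> - 1) / \<kappa>"
        using k \<open>finite L\<close> \<kappa>2[symmetric] card_gt_0_iff[of L] by (auto simp: of_nat_diff Suc_le_eq)
      also have "\<omega> v ?k = \<kappa>" using k True by (auto simp: \<omega>_def L_def)
      also have "\<kappa> + (\<kappa> * \<kappa> - 1) / \<kappa> = 2 * \<kappa> - 1 / \<kappa>" using \<kappa> by (simp add: field_simps)
      finally have "(\<Sum>l\<in>L. \<omega> v l) = 2 * \<kappa> - 1 / \<kappa>" .
      \<comment> \<open>Such a word lies in neither \<open>P\<close> nor \<open>Q\<close>, and by
        \<open>b_or_u_base\<close> at most one of its two stable edges has weight 1.\<close>
      moreover have "\<omega> v (s, True) + \<omega> v (s, False) \<le> 1 + 1 / \<kappa>"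
        using True \<open>c \<notin> X\<close> v b_or_u_base[of v] \<kappa>
        by (auto simp: \<omega>_def P_def Q_def L_def V_def u_base_def b_base_def)
      ultimately show ?thesis using split by simp
    next
      case False
      \<comment> \<open>At a root of the forest all these edges lead to children, which leaves room
        for a stable edge of weight \<kappa>.\<close>
      have "(\<Sum>l\<in>L. \<omega> v l) = (\<Sum>l\<in>L. 1 / \<kappa>)"
        using False by (intro sum.cong) (auto simp: \<omega>_def L_def)
      also have "\<dots> = \<kappa>" using \<kappa>2 \<kappa> by simp
      finally have "(\<Sum>l\<in>L. \<omega> v l) = \<kappa>" .
      moreover have "\<omega> v (s, True) + \<omega> v (s, False) \<le> \<kappa> + 1"
        using \<open>\<kappa> \<ge> 1\<close> \<kappa> \<kappa>_inv sub(3) by (auto simp: \<omega>_def)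
      ultimately show ?thesis using split by simp
    qed
  qed
  have "graph_spectral_radius (carrier (presented_group X R))
      (cayley_edges (presented_group X R) ((\<lambda>l. word_class X R [l]) ` (X \<times> UNIV)))
    \<le> (2 * \<kappa> + 1) / (2 * card X)"
  proof (rule presented_group_spectral_radius_le[where V = V and act = act and \<omega> = \<omega>])
    show "inj_on (\<lambda>l. word_class X R [l]) (X \<times> UNIV)" unfolding R_def by fact
    show "V \<noteq> {}" unfolding V_def using reduced_Nil by blast
    show "0 \<le> 2 * \<kappa> + 1" using \<kappa> by simp
  qed (simp_all add: X(1) act_in act_inv act_rel pos recip weight_sum)
  then show ?thesis unfolding \<kappa>_def .
qed

end

section \<open>The surface relator\<close>

text \<open>Arbitrary index lists allow induction and cover the tail of the relator after the first
  commutator.\<close>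

definition commutators :: "nat list \<Rightarrow> surface_gen word" where
  "commutators js =
     concat (map (\<lambda>j. [(Gen_a j, True), (Gen_b j, True), (Gen_a j, False), (Gen_b j, False)]) js)"

lemma commutators_simps [simp]:
  "commutators [] = []"
  "commutators (j # js) =
     [(Gen_a j, True), (Gen_b j, True), (Gen_a j, False), (Gen_b j, False)] @ commutators js"
  by (simp_all add: commutators_def)

lemma commutators_eq_Nil_iff [simp]: "commutators js = [] \<longleftrightarrow> js = []"
  by (cases js) auto

lemma hd_commutators: "js \<noteq> [] \<Longrightarrow> hd (commutators js) = (Gen_a (hd js), True)"
  by (cases js) auto

lemma last_commutators: "js \<noteq> [] \<Longrightarrow> last (commutators js) = (Gen_b (last js), False)"
  by (induction js) auto

lemma reduced_commutators: "reduced (commutators js)"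
  by (induction js) (auto simp: reduced_Cons hd_commutators)

lemma fst_commutators: "fst ` set (commutators js) = Gen_a ` set js \<union> Gen_b ` set js"
  by (induction js) auto

lemma surface_relator_conv:
  assumes "1 \<le> g"
  shows "surface_relator g =
    [(Gen_a 1, True), (Gen_b 1, True), (Gen_a 1, False), inv_letter (Gen_b 1, True)] @ commutators [2..<g + 1]"
proof -
  have "[1..<g + 1] = 1 # [2..<g + 1]"
    using assms upt_conv_Cons[of 1 "g + 1"] by (simp add: numeral_2_eq_2 del: upt_Suc)
  then show ?thesis by (simp add: surface_relator_def commutators_def)
qed

lemma surface_mu_le:
  assumes "2 \<le> g"
  shows "surface_mu g \<le> sqrt (4 * real g - 2) / (2 * real g) + 1 / (4 * real g)"
proof -
  let ?W = "commutators [2..<g + 1]" and ?X = "surface_gens g"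
  have fst_W: "fst ` set ?W = Gen_a ` {2..g} \<union> Gen_b ` {2..g}"
    unfolding fst_commutators by auto
  interpret hnn_word ?W "(Gen_b 1, True)"
  proof
    show "reduced ?W" by (rule reduced_commutators)
    show "?W \<noteq> []" using assms by simp
    show "inv_letter (hd ?W) \<noteq> last ?W"
      using assms by (simp add: hd_commutators last_commutators del: upt_Suc)
    show "fst (Gen_b 1, True) \<notin> fst ` set ?W" unfolding fst_W by auto
  qed
  have rel: "surface_relator g =
      [(Gen_a 1, True), (Gen_b 1, True), (Gen_a 1, False), inv_letter (Gen_b 1, True)] @ ?W"
    using surface_relator_conv[of g] assms by simp
  have "(UNIV :: surface_gen set) = range Gen_a \<union> range Gen_b"
    by (auto intro: surface_gen.exhaust)
  then have "countable (UNIV :: surface_gen set)" by (metis countable_Un countable_image countableI_type)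
  moreover have "card ?X = 2 * g"
    unfolding surface_gens_def by (subst card_Un_disjoint) (auto simp: card_image inj_on_def)
  moreover have "fst ` set ?W \<subseteq> ?X - {Gen_a 1}" unfolding fst_W by (auto simp: surface_gens_def)
  moreover have "Gen_a 0 \<notin> ?X" "Gen_a 1 \<in> ?X" "Gen_b 1 \<in> ?X" "finite ?X"
    using assms by (auto simp: surface_gens_def)
  ultimately have "surface_mu g \<le> (2 * sqrt (real (2 * (2 * g) - 2)) + 1) / (2 * (2 * g))"
    using one_relator_spectral_radius_le[of ?X "Gen_a 1" "Gen_a 0"] inj_surface_letters[of g]
    unfolding surface_mu_def surface_group_def surface_gen_set_eq rel by simp
  also have "real (2 * (2 * g) - 2) = 4 * real g - 2" using assms by (simp add: of_nat_diff)
  also have "(2 * sqrt (4 * real g - 2) + 1) / (2 * (2 * g)) =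
      sqrt (4 * real g - 2) / (2 * real g) + 1 / (4 * real g)"
    using assms by (simp add: field_simps)
  finally show ?thesis .
qed

theorem corollary3:
  shows "(\<forall>g::nat. g \<ge> 2 \<longrightarrow>
            surface_mu g \<le> sqrt (4 * real g - 2) / (2 * real g) + 1 / (4 * real g)) \<and>
         surface_mu 2 \<le> sqrt 6 / 4 + 1 / 8 \<and>
         \<bar>(sqrt 6 / 4 + 1 / 8 :: real) - 0.7373\<bar> < 0.0001"
proof (intro conjI allI impI)
  show "surface_mu 2 \<le> sqrt 6 / 4 + 1 / 8" using surface_mu_le[of 2] by simp
  have "2.4488 < sqrt (6 :: real)" by (rule real_less_rsqrt) (simp add: power2_eq_square)
  moreover have "sqrt (6 :: real) < 2.4496" by (rule real_less_lsqrt) (simp_all add: power2_eq_square)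
  ultimately show "\<bar>(sqrt 6 / 4 + 1 / 8 :: real) - 0.7373\<bar> < 0.0001"
    unfolding abs_less_iff by (auto simp: field_simps)
qed (rule surface_mu_le)

end
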